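(* Let $q$ be a non-degenerate quadratic form of dimension at least $1$ over a finite field $F$, and let $a\in F$. Then the graph $\mathcal{G}_{q,a}$ is connected, except in the following cases (in which it is not connected): (1) $a=0$ and $q$ is anisotropic over $F$; (2) $\dim(q)=1$ and either $a\notin \mathsf D(q)$ or $F$ is not isomorphic to $\mathbb{F}_p$ for a prime $p$; (3) $a\in F^\ast$, $F\in\{\mathbb{F}_2,\mathbb{F}_3,\mathbb{F}_4\}$ and $q\cong\mathbb{H}$.
   Context: A quadratic form on a finite-dimensional $F$-vector space $V$ is a map $q:V\to F$ with $q(\lambda x)=\lambda^2q(x)$ such that $b_q(x,y)=q(x+y)-q(x)-q(y)$ is bilinear; non-degenerate means $\{x: b_q(x,y)=0\ \forall y\}=\{0\}$. $q$ is anisotropic if $q(v)\neq 0$ for all $v\neq 0$. $\mathsf D(q)=\{q(v): v\in V\}\cap F^\ast$. $\mathbb{H}$ is the hyperbolic plane $F^2\to F$, $(x,y)\mapsto xy$. The representation graph $\mathcal{G}_{q,a}$ has vertex set $V$, with distinct $x,y$ adjacent iff $q(x-y)=a$. *)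

theory Defs
  imports
    "HOL-Analysis.Cartesian_Space"
    "HOL-Algebra.Algebraic_Closure_Type"
    "HOL-Number_Theory.Residues"
    "Graph_Theory.Graph_Theory"
begin

definition polar_form :: "('v::ab_group_add \<Rightarrow> 'f::field) \<Rightarrow> 'v \<Rightarrow> 'v \<Rightarrow> 'f" where
  "polar_form q x y = q (x + y) - q x - q y"

definition bilinear_form ::
    "('f::field \<Rightarrow> 'v::ab_group_add \<Rightarrow> 'v) \<Rightarrow> ('v \<Rightarrow> 'v \<Rightarrow> 'f) \<Rightarrow> bool" where
  "bilinear_form smul b \<longleftrightarrow>
     (\<forall>y. Vector_Spaces.linear smul (*) (\<lambda>x. b x y)) \<and>
     (\<forall>x. Vector_Spaces.linear smul (*) (\<lambda>y. b x y))"

definition quadratic_form ::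
    "('f::field \<Rightarrow> 'v::ab_group_add \<Rightarrow> 'v) \<Rightarrow> ('v \<Rightarrow> 'f) \<Rightarrow> bool" where
  "quadratic_form smul q \<longleftrightarrow>
     (\<forall>c x. q (smul c x) = c\<^sup>2 * q x) \<and> bilinear_form smul (polar_form q)"

text \<open>Non-degeneracy means that the radical of the polar form vanishes, in characteristic 2 as well;
  so there are no non-degenerate forms of odd dimension in characteristic 2.\<close>

definition nondegenerate :: "('v::ab_group_add \<Rightarrow> 'f::field) \<Rightarrow> bool" where
  "nondegenerate q \<longleftrightarrow> {x. \<forall>y. polar_form q x y = 0} = {0}"

definition anisotropic :: "('v::ab_group_add \<Rightarrow> 'f::field) \<Rightarrow> bool" where
  "anisotropic q \<longleftrightarrow> (\<forall>v. v \<noteq> 0 \<longrightarrow> q v \<noteq> 0)"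

definition nonzero_values :: "('v::ab_group_add \<Rightarrow> 'f::field) \<Rightarrow> 'f set" where
  "nonzero_values q = range q \<inter> (UNIV - {0})"

definition hyperbolic_plane :: "'f::field ^ 2 \<Rightarrow> 'f" where
  "hyperbolic_plane v = v $ 1 * v $ 2"

definition isometric ::
    "('f::field \<Rightarrow> 'v::ab_group_add \<Rightarrow> 'v) \<Rightarrow> ('v \<Rightarrow> 'f) \<Rightarrow>
     ('f \<Rightarrow> 'w::ab_group_add \<Rightarrow> 'w) \<Rightarrow> ('w \<Rightarrow> 'f) \<Rightarrow> bool" where
  "isometric smul\<^sub>1 q\<^sub>1 smul\<^sub>2 q\<^sub>2 \<longleftrightarrow>
     (\<exists>f. Vector_Spaces.linear smul\<^sub>1 smul\<^sub>2 f \<and> bij f \<and> (\<forall>v. q\<^sub>2 (f v) = q\<^sub>1 v))"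

text \<open>The undirected graph is encoded as a digraph containing both arcs of every edge
  (the arc set is symmetric when q is a quadratic form, since then q is even).\<close>

definition representation_graph ::
    "('v::ab_group_add \<Rightarrow> 'f::field) \<Rightarrow> 'f \<Rightarrow> 'v pair_pre_digraph" where
  "representation_graph q a = \<lparr>pverts = UNIV, parcs = {(x, y). x \<noteq> y \<and> q (x - y) = a}\<rparr>"

definition is_prime_field :: "'f::field itself \<Rightarrow> bool" where
  "is_prime_field _ \<longleftrightarrow>
     (\<exists>p::nat. prime p \<and> (ring_of_type_algebra :: 'f ring) \<simeq> residue_ring (int p))"

end

theory Submission
  imports Defs
begin

text \<open>
The graph is connected iff the vectors of norm \<open>a\<close> generate the additive group of the space; let \<open>W\<close>
be the subgroup that they generate.

If \<open>q\<close> is isotropic, split off a hyperbolic plane with basis \<open>e, f\<close>; once \<open>W\<close> contains all multiples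
of \<open>e\<close> and \<open>f\<close> it is everything, since any \<open>u\<close> orthogonal to the plane is the component of some
\<open>e + c f + u\<close> of norm \<open>a\<close>. Such multiples arise from a vector orthogonal to the plane or, in the plane
itself, from \<open>1/x + 1/y - 1/(x + y)\<close> being nonzero for suitable \<open>x, y\<close> in a field with at least five
elements. In fields with two, three or four elements inversion is additive, which makes the
hyperbola \<open>x y = a\<close> lie in a proper subgroup.

If \<open>q\<close> is anisotropic, the dimension is at most two. On a plane, \<open>W\<close> is stable under reflections in
vectors of norm \<open>a\<close>, which produces so many scalars preserving \<open>W\<close> that \<open>W\<close> is a subspace. On a
line there are exactly two vectors of norm \<open>a\<close>, and they generate a copy of the prime field.
\<close>

section \<open>Finite fields\<close>

lemma card_le_mult_card_image:
  assumes "finite A" and "\<And>y. y \<in> f ` A \<Longrightarrow> card {x \<in> A. f x = y} \<le> k"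
  shows "card A \<le> k * card (f ` A)"
proof -
  have "A = (\<Union>y\<in>f ` A. {x \<in> A. f x = y})"
    by auto
  then have "card A \<le> (\<Sum>y\<in>f ` A. card {x \<in> A. f x = y})"
    using card_UN_le[of "f ` A" "\<lambda>y. {x \<in> A. f x = y}"] assms(1) by simp
  also have "\<dots> \<le> (\<Sum>y\<in>f ` A. k)"
    using assms(2) by (rule sum_mono)
  finally show ?thesis
    by (simp add: mult.commute)
qed

text \<open>Subtracting the equation of a known root \<open>r\<close> leaves a factor
  \<open>x - r\<close>, so the only other candidate is
  \<open>- \<beta> / \<alpha> - r\<close>.\<close>

lemma card_quadratic_roots_le:
  fixes \<alpha> \<beta> \<gamma> :: "'f::field"
  assumes "\<alpha> \<noteq> 0"
  shows "card {x. \<alpha> * x\<^sup>2 + \<beta> * x + \<gamma> = 0} \<le> 2"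
proof (cases "\<exists>r. \<alpha> * r\<^sup>2 + \<beta> * r + \<gamma> = 0")
  case True
  then obtain r where r: "\<alpha> * r\<^sup>2 + \<beta> * r + \<gamma> = 0"
    by blast
  have "x = r \<or> x = - \<beta> / \<alpha> - r" if "\<alpha> * x\<^sup>2 + \<beta> * x + \<gamma> = 0" for x
  proof -
    have "(x - r) * (\<alpha> * (x + r) + \<beta>) = (\<alpha> * x\<^sup>2 + \<beta> * x + \<gamma>) - (\<alpha> * r\<^sup>2 + \<beta> * r + \<gamma>)"
      by (simp add: algebra_simps power2_eq_square)
    then have "x = r \<or> \<alpha> * (x + r) + \<beta> = 0"
      using r that by simp
    moreover have "x = - \<beta> / \<alpha> - r" if "\<alpha> * (x + r) + \<beta> = 0"
    proof -
      have "\<alpha> * (x + r) = - \<beta>"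
        using that by (simp add: eq_neg_iff_add_eq_0)
      then have "x + r = - \<beta> / \<alpha>"
        using nonzero_mult_div_cancel_left[OF assms, of "x + r"] by simp
      then show ?thesis
        by (simp add: algebra_simps)
    qed
    ultimately show ?thesis
      by blast
  qed
  then have "{x. \<alpha> * x\<^sup>2 + \<beta> * x + \<gamma> = 0} \<subseteq> {r, - \<beta> / \<alpha> - r}"
    by auto
  then have "card {x. \<alpha> * x\<^sup>2 + \<beta> * x + \<gamma> = 0} \<le> card {r, - \<beta> / \<alpha> - r}"
    by (intro card_mono) auto
  also have "\<dots> \<le> 2"
    by (simp add: card_insert_if)
  finally show ?thesis .
qed simp

text \<open>In characteristic two \<open>(x - z)\<^sup>2 = x\<^sup>2 - z\<^sup>2\<close>, so
  squaring is injective, hence surjective on a finite field.\<close>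

lemma char_two_square_surj:
  fixes y :: "'f::{field,finite}"
  assumes "(2::'f) = 0"
  obtains x where "x\<^sup>2 = y"
proof -
  have "inj (\<lambda>x::'f. x\<^sup>2)"
  proof (rule injI)
    fix x z :: 'f
    assume "x\<^sup>2 = z\<^sup>2"
    moreover have "(x - z)\<^sup>2 = x\<^sup>2 - z\<^sup>2 + 2 * (z * (z - x))"
      by (simp add: algebra_simps power2_eq_square)
    ultimately have "(x - z)\<^sup>2 = 0"
      using assms by simp
    then show "x = z"
      by simp
  qed
  then show ?thesis
    using that finite_UNIV_inj_surj[of "\<lambda>x::'f. x\<^sup>2"] by (metis finite surjD)
qed

text \<open>Pigeonhole: more than half of the field elements are squares, so the values of
  \<open>c * x\<^sup>2\<close> and of \<open>a - d * y\<^sup>2\<close> must meet.\<close>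

lemma binary_diagonal_form_surj:
  fixes c d a :: "'f::{field,finite}"
  assumes "c \<noteq> 0" and "d \<noteq> 0"
  obtains x y where "c * x\<^sup>2 + d * y\<^sup>2 = a"
proof -
  let ?sq = "\<lambda>x::'f. x\<^sup>2"
  let ?X = "(\<lambda>x. c * x) ` range ?sq" and ?Y = "(\<lambda>y. a - d * y) ` range ?sq"
  have "card {x \<in> UNIV - {0}. x\<^sup>2 = y} \<le> 2" for y :: 'f
  proof -
    have "card {x \<in> UNIV - {0}. x\<^sup>2 = y} \<le> card {x. 1 * x\<^sup>2 + 0 * x + - y = 0}"
      by (intro card_mono) auto
    then show ?thesis
      by (rule order.trans) (rule card_quadratic_roots_le, simp)
  qed
  then have "card (UNIV - {0::'f}) \<le> 2 * card (?sq ` (UNIV - {0}))"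
    by (intro card_le_mult_card_image) auto
  moreover have "range ?sq = insert 0 (?sq ` (UNIV - {0}))"
    by (auto simp: image_iff)
  then have "card (range ?sq) = Suc (card (?sq ` (UNIV - {0})))"
    by (metis (no_types, lifting) DiffD2 card_insert_disjoint finite imageE insertI1 power_eq_0_iff)
  ultimately have "CARD('f) < 2 * card (range ?sq)"
    by (simp add: card_Diff_singleton_if)
  moreover have "card ?X = card (range ?sq)" and "card ?Y = card (range ?sq)"
    using assms by (auto intro!: card_image simp: inj_on_def)
  moreover have "card (?X \<union> ?Y) \<le> CARD('f)"
    by (intro card_mono) auto
  ultimately have "?X \<inter> ?Y \<noteq> {}"
    using card_Un_disjoint[of ?X ?Y] by fastforce
  then obtain x y where "c * x\<^sup>2 = a - d * y\<^sup>2"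
    by blast
  then have "c * x\<^sup>2 + d * y\<^sup>2 = a"
    by (simp add: eq_diff_eq)
  then show ?thesis
    by (rule that)
qed

text \<open>A coset \<open>v + K\<close> with \<open>v \<notin> K\<close> would be disjoint from
  \<open>K\<close> and equally large.\<close>

lemma two_mult_card_gt_imp_UNIV:
  fixes K :: "'a::{ab_group_add,finite} set"
  assumes diff: "\<And>x y. x \<in> K \<Longrightarrow> y \<in> K \<Longrightarrow> x - y \<in> K"
    and card: "CARD('a) < 2 * card K"
  shows "K = UNIV"
proof (rule ccontr)
  assume "K \<noteq> UNIV"
  then obtain v where v: "v \<notin> K"
    by blast
  have "K \<inter> (+) v ` K = {}"
  proof -
    have "v \<in> K" if "x \<in> K" and "v + x \<in> K" for x
      using diff[OF that(2,1)] by simp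
    then show ?thesis
      using v by auto
  qed
  moreover have "card ((+) v ` K) = card K"
    by (intro card_image) simp
  moreover have "card (K \<union> (+) v ` K) \<le> CARD('a)"
    by (intro card_mono) auto
  ultimately show False
    using card card_Un_disjoint[of K "(+) v ` K"] by (simp add: finite_subset[OF subset_UNIV])
qed

text \<open>The image of the integers has \<open>CHAR('f)\<close> elements. If it is everything,
  \<open>of_int\<close> is an isomorphism from the residue ring; conversely, a field with
  \<open>p\<close> elements has characteristic \<open>p\<close>, so the image fills it.\<close>

lemma range_of_int_eq_UNIV_iff_prime_field:
  "range (of_int :: int \<Rightarrow> 'f::{field,finite}) = UNIV \<longleftrightarrow> is_prime_field TYPE('f)"
proof
  let ?p = "CHAR('f)"
  have prime: "prime ?p"
    by (simp add: finite_imp_CHAR_pos prime_CHAR_semidom)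
  have bij_upt: "bij_betw (of_int :: int \<Rightarrow> 'f) {0..int ?p - 1} (range of_int)"
    unfolding bij_betw_def
  proof
    show "inj_on (of_int :: int \<Rightarrow> 'f) {0..int ?p - 1}"
      by (auto simp: inj_on_def of_int_eq_iff_cong_CHAR cong_def)
    have "of_int x \<in> (of_int :: int \<Rightarrow> 'f) ` {0..int ?p - 1}" for x
      using prime_gt_0_nat[OF prime]
      by (intro image_eqI[of _ _ "x mod int ?p"]) (auto simp: of_int_eq_iff_cong_CHAR)
    then show "(of_int :: int \<Rightarrow> 'f) ` {0..int ?p - 1} = range of_int"
      by auto
  qed
  {
    assume "range (of_int :: int \<Rightarrow> 'f) = UNIV"
    interpret residues "int ?p" "residue_ring (int ?p)"
      using prime_gt_1_nat[OF prime] by unfold_locales auto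
    have "(of_int :: int \<Rightarrow> 'f) \<in> ring_iso (residue_ring (int ?p)) ring_of_type_algebra"
    proof (rule ring_iso_memI)
      show "bij_betw (of_int :: int \<Rightarrow> 'f) (carrier (residue_ring (int ?p)))
              (carrier ring_of_type_algebra)"
        using bij_upt \<open>range of_int = UNIV\<close>
        by (simp add: residue_ring_def ring_of_type_algebra_def)
    qed (auto simp: residue_ring_def ring_of_type_algebra_def of_int_eq_iff_cong_CHAR
           simp flip: of_int_mult of_int_add)
    then have "(ring_of_type_algebra :: 'f ring) \<simeq> residue_ring (int ?p)"
      unfolding is_ring_iso_def using ring_iso_set_sym[OF ring_axioms] by blast
    then show "is_prime_field TYPE('f)"
      unfolding is_prime_field_def using prime by blast
  }
  {
    assume "is_prime_field TYPE('f)"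
    then obtain p :: nat and h where p: "prime p"
      and h: "h \<in> ring_iso (ring_of_type_algebra :: 'f ring) (residue_ring (int p))"
      unfolding is_prime_field_def is_ring_iso_def by blast
    have "bij_betw h (UNIV :: 'f set) {0..int p - 1}"
      using h by (simp add: ring_iso_def ring_of_type_algebra_def residue_ring_def)
    then have "CARD('f) = p"
      using bij_betw_same_card by fastforce
    then have "?p = p"
      using CHAR_dvd_CARD[where ?'a = 'f] p prime by (simp add: primes_dvd_imp_eq)
    then have "card (range (of_int :: int \<Rightarrow> 'f)) = CARD('f)"
      using bij_betw_same_card[OF bij_upt] \<open>CARD('f) = p\<close> by simp
    then show "range (of_int :: int \<Rightarrow> 'f) = UNIV"
      by (intro card_subset_eq) auto
  }
qed

text \<open>Multiplication by \<open>x\<close> permutes the nonzero elements, so it does not change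
  their product.\<close>

lemma finite_field_power_card_minus_1:
  fixes x :: "'f::{field,finite}"
  assumes "x \<noteq> 0"
  shows "x ^ (CARD('f) - 1) = 1"
proof -
  have "bij_betw ((*) x) (UNIV - {0}) (UNIV - {0})"
    using assms by (intro bij_betw_byWitness[of _ "\<lambda>y. y / x"]) auto
  then have "(\<Prod>y\<in>UNIV - {0}. x * y) = \<Prod>(UNIV - {0})"
    by (rule prod.reindex_bij_betw)
  then have "x ^ (CARD('f) - 1) * \<Prod>(UNIV - {0}) = 1 * \<Prod>(UNIV - {0::'f})"
    by (simp add: prod.distrib card_Diff_singleton)
  then show ?thesis
    by (simp only: mult_cancel_right) simp
qed

text \<open>On nonzero elements inversion is the identity if the field has two or three elements,
  and squaring if it has four, where the characteristic is two.\<close>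

lemma additive_inverse_small_field:
  assumes "CARD('f::{field,finite}) \<in> {2, 3, 4}"
  obtains \<phi> :: "'f::{field,finite} \<Rightarrow> 'f"
    where "\<And>x y. \<phi> (x - y) = \<phi> x - \<phi> y" and "\<And>x. x \<noteq> 0 \<Longrightarrow> x * \<phi> x = 1"
proof -
  have inv: "x * x ^ (CARD('f) - 2) = 1" if "x \<noteq> 0" for x :: 'f
  proof -
    have "x * x ^ (CARD('f) - 2) = x ^ (CARD('f) - 1)"
      using assms by (auto simp: numeral_eq_Suc)
    then show ?thesis
      using finite_field_power_card_minus_1[OF that] by simp
  qed
  show ?thesis
  proof (cases "CARD('f) = 4")
    case True
    then have "CHAR('f) dvd 4"
      using CHAR_dvd_CARD[where ?'a = 'f] by simp
    then have "of_nat 4 = (0 :: 'f)"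
      by (simp only: of_nat_eq_0_iff_char_dvd)
    then have "(2::'f) * 2 = 0"
      by simp
    then have "(2::'f) = 0"
      using mult_eq_0_iff by blast
    then have "(x - y)\<^sup>2 = x\<^sup>2 - y\<^sup>2" for x y :: 'f
    proof -
      have "(x - y)\<^sup>2 = x\<^sup>2 - y\<^sup>2 + 2 * (y * (y - x))"
        by (simp add: algebra_simps power2_eq_square)
      then show ?thesis
        using \<open>2 = 0\<close> by simp
    qed
    then show ?thesis
      using that[of "\<lambda>x. x\<^sup>2"] inv True by simp
  next
    case False
    then have "CARD('f) = 2 \<or> CARD('f) = 3"
      using assms by simp
    moreover have "x * x = 1" if "x \<noteq> 0" "CARD('f) = 2 \<or> CARD('f) = 3" for x :: 'f
      using inv[OF that(1)] that(2) by auto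
    \<comment> \<open>The identity replaces \<open>x ^ (CARD('f) - 2)\<close>, which for two
      elements is the constant \<open>1\<close> and so not additive.\<close>
    ultimately show ?thesis
      using that[of "\<lambda>x. x"] by simp
  qed
qed

text \<open>At most four elements are excluded. The conditions make
  \<open>1 / r + 1 - 1 / (r + 1)\<close> well defined and nonzero.\<close>

lemma ex_nonroot_if_card_ge_5:
  assumes "CARD('f::{field,finite}) \<ge> 5"
  obtains r :: "'f::{field,finite}" where "r \<noteq> 0" and "r + 1 \<noteq> 0" and "r\<^sup>2 + r + 1 \<noteq> 0"
proof -
  let ?R = "{x::'f. 1 * x\<^sup>2 + 1 * x + 1 = 0}"
  have "card ({0, -1} \<union> ?R) \<le> card {0, -1::'f} + card ?R"
    by (rule card_Un_le)
  also have "\<dots> \<le> 2 + 2"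
    using card_quadratic_roots_le[of 1 1 "1::'f"] by (intro add_mono) (auto simp: card_insert_if)
  finally have "card ({0, -1} \<union> ?R) < CARD('f)"
    using assms by linarith
  then have "{0, -1} \<union> ?R \<noteq> UNIV"
    by (metis less_irrefl)
  then obtain r where "r \<notin> {0, -1} \<union> ?R"
    by blast
  then show ?thesis
    using that[of r] by (auto simp: eq_neg_iff_add_eq_0)
qed

section \<open>Connectedness as generation of the additive group\<close>

text \<open>The generated subgroup, built one generator at a time so that the rules
  \<open>add\<close> and \<open>diff\<close> match steps in the graph.\<close>

inductive_set additive_span :: "'v::ab_group_add set \<Rightarrow> 'v set" for S where
  zero: "0 \<in> additive_span S"
| add: "w \<in> additive_span S \<Longrightarrow> s \<in> S \<Longrightarrow> w + s \<in> additive_span S"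
| diff: "w \<in> additive_span S \<Longrightarrow> s \<in> S \<Longrightarrow> w - s \<in> additive_span S"

lemma additive_span_base: "s \<in> S \<Longrightarrow> s \<in> additive_span S"
  using additive_span.add[OF additive_span.zero, of s S] by simp

lemma additive_span_add:
  assumes "v \<in> additive_span S" and "w \<in> additive_span S"
  shows "v + w \<in> additive_span S"
  using assms(2)
proof induction
  case (add w s)
  then show ?case
    using additive_span.add[of "v + w"] by (simp add: add.assoc)
next
  case (diff w s)
  then show ?case
    using additive_span.diff[of "v + w"] by (simp add: add_diff_eq)
qed (use assms(1) in simp)

lemma additive_span_diff:
  assumes "v \<in> additive_span S" and "w \<in> additive_span S"
  shows "v - w \<in> additive_span S"
  using assms(2)
proof induction
  case (add w s)
  then show ?case
    using additive_span.diff[of "v - w"] by (simp add: diff_diff_eq)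
next
  case (diff w s)
  then show ?case
    using additive_span.add[of "v - w"] by (simp add: algebra_simps)
qed (use assms(1) in simp)

lemma additive_span_subset:
  assumes "S \<subseteq> T" and "0 \<in> T" and "\<And>v w. v \<in> T \<Longrightarrow> w \<in> T \<Longrightarrow> v - w \<in> T"
  shows "additive_span S \<subseteq> T"
proof
  fix v
  assume "v \<in> additive_span S"
  then show "v \<in> T"
  proof induction
    case (add w s)
    then have "w - (0 - s) \<in> T"
      using assms by blast
    then show ?case
      by simp
  qed (use assms in blast)+
qed

text \<open>Connectedness refers to the symmetrised digraph, whose arcs add or subtract a vector of
  norm \<open>a\<close>; so \<open>v\<close> is reachable from \<open>u\<close> exactly when
  \<open>v - u\<close> lies in the span.\<close>

lemma connected_iff_additive_span:
  fixes q :: "'v::ab_group_add \<Rightarrow> 'f::field"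
  shows "Digraph_Component.connected (with_proj (representation_graph q a)) \<longleftrightarrow>
    additive_span {v. q v = a} = UNIV"
proof -
  let ?H = "with_proj (mk_symmetric (with_proj (representation_graph q a)))"
  have arcs: "(x, y) \<in> arcs_ends ?H \<longleftrightarrow> x \<noteq> y \<and> (q (x - y) = a \<or> q (y - x) = a)" for x y
    by (simp add: parcs_mk_symmetric representation_graph_def arcs_ends_def arc_to_ends_def) metis
  have step: "x \<rightarrow>\<^sup>*\<^bsub>?H\<^esub> y"
    if "x \<rightarrow>\<^sup>*\<^bsub>?H\<^esub> z" and "q (z - y) = a \<or> q (y - z) = a" for x y z
  \<comment> \<open>The graph has no loops, so the generator \<open>0\<close>, which occurs if
    \<open>q 0 = a\<close>, has to be a trivial step.\<close>
  proof (cases "z = y")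
    case False
    then have "(z, y) \<in> arcs_ends ?H"
      using that(2) arcs by blast
    then show ?thesis
      using that(1) unfolding reachable_def
      by - (rule rtrancl_on_into_rtrancl_on[where b = z], simp_all add: representation_graph_def)
  qed (use that in simp)
  have "u \<rightarrow>\<^sup>*\<^bsub>?H\<^esub> v \<longleftrightarrow> v - u \<in> additive_span {v. q v = a}" for u v
  proof
    assume "u \<rightarrow>\<^sup>*\<^bsub>?H\<^esub> v"
    then show "v - u \<in> additive_span {v. q v = a}"
      unfolding reachable_def
    proof (induction rule: rtrancl_on_induct)
      case (step y z)
      then consider "q (z - y) = a" | "q (y - z) = a"
        using arcs by blast
      then show ?case
      proof cases
        case 1
        then show ?thesis
          using additive_span.add[OF step.IH, of "z - y"] by simp
      next
        case 2
        then show ?thesis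
          using additive_span.diff[OF step.IH, of "y - z"] by simp
      qed
    qed (simp add: additive_span.zero)
  next
    have "u \<rightarrow>\<^sup>*\<^bsub>?H\<^esub> (u + w)" if "w \<in> additive_span {v. q v = a}" for w
      using that
    proof induction
      case zero
      show ?case
        by (simp add: reachable_def representation_graph_def)
    next
      case (add w s)
      have "u + (w + s) - (u + w) = s"
        by (simp add: algebra_simps)
      then show ?case
        using step[OF add.IH, of "u + (w + s)"] add.hyps(2) by simp
    next
      case (diff w s)
      have "u + w - (u + (w - s)) = s"
        by (simp add: algebra_simps)
      then show ?case
        using step[OF diff.IH, of "u + (w - s)"] diff.hyps(2) by simp
    qed
    from this[of "v - u"]
    show "u \<rightarrow>\<^sup>*\<^bsub>?H\<^esub> v" if "v - u \<in> additive_span {v. q v = a}"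
      using that by simp
  qed
  moreover have "Digraph_Component.connected (with_proj (representation_graph q a)) \<longleftrightarrow>
      (\<forall>u v. u \<rightarrow>\<^sup>*\<^bsub>?H\<^esub> v)"
    by (simp add: connected_def strongly_connected_def representation_graph_def)
  moreover have "(\<forall>u v. v - u \<in> W) \<longleftrightarrow> W = UNIV" for W :: "'v set"
  proof
    assume *: "\<forall>u v. v - u \<in> W"
    have "v \<in> W" for v
      using *[rule_format, of v 0] by simp
    then show "W = UNIV"
      by blast
  qed simp
  ultimately show ?thesis
    by (simp only:)
qed

section \<open>Quadratic spaces\<close>

locale quadratic_space = vector_space smul
  for smul :: "'f::field \<Rightarrow> 'v::ab_group_add \<Rightarrow> 'v" (infixr \<open>\<cdot>\<close> 75) +
  fixes q :: "'v \<Rightarrow> 'f"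
  assumes quadratic: "quadratic_form smul q"
    and nondegenerate: "nondegenerate q"
begin

abbreviation B where "B \<equiv> polar_form q"

lemma q_scale [simp]: "q (c \<cdot> x) = c\<^sup>2 * q x"
  using quadratic by (simp add: quadratic_form_def)

lemma linear_B_left: "Vector_Spaces.linear smul (*) (\<lambda>x. B x y)"
  and linear_B_right: "Vector_Spaces.linear smul (*) (\<lambda>y. B x y)"
  using quadratic unfolding quadratic_form_def bilinear_form_def by blast+

lemma B_left [simp]:
  "B (x + y) z = B x z + B y z" "B (x - y) z = B x z - B y z" "B (- x) z = - B x z"
  "B (c \<cdot> x) z = c * B x z" "B 0 z = 0"
proof -
  interpret Vector_Spaces.linear smul "(*)" "\<lambda>x. B x z"
    by (rule linear_B_left)
  show "B (x + y) z = B x z + B y z" "B (x - y) z = B x z - B y z" "B (- x) z = - B x z"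
    "B (c \<cdot> x) z = c * B x z" "B 0 z = 0"
    by (fact add diff neg scale zero)+
qed

lemma B_right [simp]:
  "B x (y + z) = B x y + B x z" "B x (y - z) = B x y - B x z" "B x (- y) = - B x y"
  "B x (c \<cdot> y) = c * B x y" "B x 0 = 0"
proof -
  interpret Vector_Spaces.linear smul "(*)" "\<lambda>y. B x y"
    by (rule linear_B_right)
  show "B x (y + z) = B x y + B x z" "B x (y - z) = B x y - B x z" "B x (- y) = - B x y"
    "B x (c \<cdot> y) = c * B x y" "B x 0 = 0"
    by (fact add diff neg scale zero)+
qed

lemma B_commute: "B x y = B y x"
  by (simp add: polar_form_def add.commute)

lemma q_add: "q (x + y) = q x + q y + B x y"
  by (simp add: polar_form_def)

lemma q_zero [simp]: "q 0 = 0"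
  using q_scale[of 0 0] by simp

lemma q_uminus [simp]: "q (- x) = q x"
  using q_scale[of "-1" x] by simp

lemma q_diff: "q (x - y) = q x + q y - B x y"
  using q_add[of x "- y"] by simp

lemma B_self [simp]: "B x x = 2 * q x"
proof -
  have "2 \<cdot> x = x + x"
    using scale_left_distrib[of 1 1 x] by simp
  then have "q (x + x) = 2\<^sup>2 * q x"
    using q_scale[of 2 x] by (simp only:)
  then show ?thesis
    by (simp add: polar_form_def)
qed

lemma nondegenerateD: "(\<And>y. B x y = 0) \<Longrightarrow> x = 0"
  using nondegenerate unfolding nondegenerate_def by blast

text \<open>Nondegeneracy gives \<open>g\<close> with \<open>B e g = 1\<close>. Subtracting
  \<open>q g \<cdot> e\<close> removes the norm of \<open>g\<close> and keeps the pairing, because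
  \<open>e\<close> is isotropic.\<close>

lemma hyperbolic_pair:
  assumes "q e = 0" and "e \<noteq> 0"
  obtains f where "q f = 0" and "B e f = 1"
proof -
  obtain w where w: "B e w \<noteq> 0"
    using nondegenerateD[of e] assms(2) by blast
  define g where "g = (1 / B e w) \<cdot> w"
  have "B e g = 1"
    using w by (simp add: g_def)
  then have "q (g - q g \<cdot> e) = 0" and "B e (g - q g \<cdot> e) = 1"
    using assms(1) by (simp_all add: q_diff B_commute[of g e])
  then show ?thesis
    by (rule that)
qed

text \<open>If \<open>B u e \<noteq> 0\<close>, then \<open>u\<close> differs from an isotropic vector by a multiple of \<open>e\<close>;
  if \<open>B u e = 0\<close>, the same applies to \<open>u + f\<close> and to \<open>f\<close>.\<close>

lemma isotropic_vectors_span: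
  assumes "\<not> anisotropic q"
  shows "additive_span {v. q v = 0} = UNIV"
proof -
  obtain e where e: "q e = 0" "e \<noteq> 0"
    using assms unfolding anisotropic_def by blast
  then obtain f where f: "q f = 0" "B e f = 1"
    by (rule hyperbolic_pair)
  have nonorth: "u \<in> additive_span {v. q v = 0}" if "B u e \<noteq> 0" for u
  proof -
    let ?t = "q u / B u e"
    have "q (u - ?t \<cdot> e) = 0" and "q (?t \<cdot> e) = 0"
      using that e by (simp_all add: q_diff)
    then have "(u - ?t \<cdot> e) + ?t \<cdot> e \<in> additive_span {v. q v = 0}"
      by (intro additive_span_add additive_span_base) auto
    then show ?thesis
      by simp
  qed
  have "u \<in> additive_span {v. q v = 0}" for u
  proof (cases "B u e = 0")
    case True
    then have "(u + f) - f \<in> additive_span {v. q v = 0}"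
      using f by (intro additive_span_diff nonorth) (simp_all add: B_commute[of f e])
    then show ?thesis
      by simp
  qed (rule nonorth)
  then show ?thesis
    by auto
qed

lemma anisotropic_zero_not_span:
  assumes "anisotropic q" and "(x::'v) \<noteq> 0"
  shows "additive_span {v. q v = 0} \<noteq> UNIV"
proof -
  have "additive_span {v. q v = 0} \<subseteq> {0}"
    using assms(1) by (intro additive_span_subset) (auto simp: anisotropic_def)
  then have "x \<notin> additive_span {v. q v = 0}"
    using assms(2) by auto
  then show ?thesis
    by auto
qed

text \<open>A reflection only if \<open>q d \<noteq> 0\<close>; otherwise the division yields the identity.\<close>

definition reflect :: "'v \<Rightarrow> 'v \<Rightarrow> 'v" where
  "reflect d v = v - (B v d / q d) \<cdot> d"

lemma q_reflect: "q d \<noteq> 0 \<Longrightarrow> q (reflect d v) = q v"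
  by (simp add: reflect_def q_diff power2_eq_square)

lemma B_reflect: "q d \<noteq> 0 \<Longrightarrow> B (reflect d v) (reflect d w) = B v w"
  by (simp add: reflect_def B_commute[of d v] B_commute[of d w])

text \<open>Equal norms give \<open>B s (s - t) = q (s - t)\<close>, so the coefficient in the
  reflection is \<open>1\<close>.\<close>

lemma reflect_diff:
  assumes "q s = q t" and "q (s - t) \<noteq> 0"
  shows "reflect (s - t) s = t"
proof -
  have "B s (s - t) = q (s - t)"
    using assms(1) by (simp add: q_diff)
  then show ?thesis
    using assms(2) by (simp add: reflect_def)
qed

end

locale finite_quadratic_space = quadratic_space smul q
  for smul :: "'f::{field,finite} \<Rightarrow> 'v::ab_group_add \<Rightarrow> 'v" (infixr \<open>\<cdot>\<close> 75)
    and q :: "'v \<Rightarrow> 'f"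

section \<open>Isotropic spaces\<close>

locale hyperbolic_decomposition = finite_quadratic_space smul q
  for smul :: "'f::{field,finite} \<Rightarrow> 'v::ab_group_add \<Rightarrow> 'v" (infixr \<open>\<cdot>\<close> 75)
    and q :: "'v \<Rightarrow> 'f" +
  fixes e f :: 'v
  assumes q_e [simp]: "q e = 0" and q_f [simp]: "q f = 0" and B_e_f [simp]: "B e f = 1"
begin

lemma B_f_e [simp]: "B f e = 1"
  by (simp add: B_commute[of f e])

definition orth :: "'v set" where
  "orth = {u. B e u = 0 \<and> B f u = 0}"

lemma q_decomposition:
  assumes "u \<in> orth"
  shows "q (x \<cdot> e + y \<cdot> f + u) = x * y + q u"
  using assms by (simp add: orth_def q_add)

lemma q_plane: "q (x \<cdot> e + y \<cdot> f) = x * y"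
  by (simp add: q_add)

lemma decomposition:
  obtains u where "u \<in> orth" and "v = B v f \<cdot> e + B v e \<cdot> f + u"
proof
  show "v - B v f \<cdot> e - B v e \<cdot> f \<in> orth"
    by (simp add: orth_def B_commute[of e v] B_commute[of f v])
qed simp

lemma span_eq_UNIV_if_multiples:
  assumes e: "\<And>c. c \<cdot> e \<in> additive_span {v. q v = a}"
    and f: "\<And>c. c \<cdot> f \<in> additive_span {v. q v = a}"
  shows "additive_span {v. q v = a} = UNIV"
proof -
  have "v \<in> additive_span {v. q v = a}" for v
  proof -
    obtain u where u: "u \<in> orth" and v: "v = B v f \<cdot> e + B v e \<cdot> f + u"
      by (rule decomposition)
    have "1 \<cdot> e + (a - q u) \<cdot> f + u \<in> additive_span {v. q v = a}"
      using q_decomposition[OF u, of 1 "a - q u"] by (intro additive_span_base) simp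
    from additive_span_diff[OF this additive_span_add[OF e f]]
    have "(1 \<cdot> e + (a - q u) \<cdot> f + u) - (1 \<cdot> e + (a - q u) \<cdot> f)
        \<in> additive_span {v. q v = a}" .
    then have "u \<in> additive_span {v. q v = a}"
      by (simp only: add_diff_cancel_left')
    then show ?thesis
      by (subst v) (intro additive_span_add e f)
  qed
  then show ?thesis
    by auto
qed

text \<open>For \<open>c \<noteq> 0\<close> the vector
  \<open>c \<cdot> e + (a / c) \<cdot> f\<close> has norm \<open>a\<close>, so the multiples of
  \<open>e\<close> come for free.\<close>

lemma span_eq_UNIV_if_multiples_f:
  assumes "a \<noteq> 0" and f: "\<And>c. c \<noteq> 0 \<Longrightarrow> c \<cdot> f \<in> additive_span {v. q v = a}"
  shows "additive_span {v. q v = a} = UNIV"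
proof (rule span_eq_UNIV_if_multiples)
  fix c
  show "c \<cdot> f \<in> additive_span {v. q v = a}"
    using f by (cases "c = 0") (simp_all add: additive_span.zero)
  show "c \<cdot> e \<in> additive_span {v. q v = a}"
  proof (cases "c = 0")
    case False
    then have "c \<cdot> e + (a / c) \<cdot> f \<in> additive_span {v. q v = a}"
      by (intro additive_span_base) (simp add: q_plane)
    then have "c \<cdot> e + (a / c) \<cdot> f - (a / c) \<cdot> f \<in> additive_span {v. q v = a}"
      using False assms(1) by (intro additive_span_diff f) simp_all
    then show ?thesis
      by simp
  qed (simp add: additive_span.zero)
qed

text \<open>With \<open>s x = x e + (a/x) f\<close>, the combination \<open>s (r z) + s z - s ((r + 1) z)\<close> has no
  \<open>e\<close>-component.\<close>

lemma span_eq_UNIV_if_card_ge_5: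
  assumes "a \<noteq> 0" and "CARD('f) \<ge> 5"
  shows "additive_span {v. q v = a} = UNIV"
proof (rule span_eq_UNIV_if_multiples_f[OF assms(1)])
  fix c :: 'f
  assume c: "c \<noteq> 0"
  obtain r :: 'f where r: "r \<noteq> 0" "r + 1 \<noteq> 0" "r\<^sup>2 + r + 1 \<noteq> 0"
    using ex_nonroot_if_card_ge_5[OF assms(2)] by metis
  \<comment> \<open>Up to the factor \<open>a / z\<close> this is the \<open>f\<close>-coefficient
    of the combination; it equals \<open>(r\<^sup>2 + r + 1) / (r * (r + 1))\<close>.\<close>
  define k where "k = 1 / r + 1 - 1 / (r + 1)"
  have "(1 / r + 1 - 1 / p) * (r * p) = p + r * p - r" if "p \<noteq> 0" for p
    using r(1) that by (simp add: field_simps)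
  from this[OF r(2)] have "k * (r * (r + 1)) = r\<^sup>2 + r + 1"
    by (simp add: k_def algebra_simps power2_eq_square)
  then have "k \<noteq> 0"
    using r(3) by auto
  \<comment> \<open>Chosen so that the \<open>f\<close>-coefficient \<open>a * k / z\<close> becomes
    \<open>c\<close>.\<close>
  define z where "z = a * k / c"
  have "z \<noteq> 0"
    using \<open>k \<noteq> 0\<close> c assms(1) by (simp add: z_def)
  let ?s = "\<lambda>x. x \<cdot> e + (a / x) \<cdot> f"
  have s: "?s x \<in> additive_span {v. q v = a}" if "x \<noteq> 0" for x
    using that by (intro additive_span_base) (simp add: q_plane)
  have "?s (r * z) + ?s z - ?s ((r + 1) * z) \<in> additive_span {v. q v = a}"
    using r \<open>z \<noteq> 0\<close> by (intro additive_span_add additive_span_diff s) simp_all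
  moreover have "?s (r * z) + ?s z - ?s ((r + 1) * z) =
      (r * z + z - (r + 1) * z) \<cdot> e + (a / (r * z) + a / z - a / ((r + 1) * z)) \<cdot> f"
    by (simp only: scale_left_distrib scale_left_diff_distrib) (simp add: algebra_simps)
  moreover have "r * z + z - (r + 1) * z = 0"
    by (simp add: algebra_simps)
  moreover have "a / (r * z) + a / z - a / (p * z) = a * (1 / r + 1 - 1 / p) / z" for p
    by (simp add: distrib_left right_diff_distrib add_divide_distrib diff_divide_distrib)
  then have "a / (r * z) + a / z - a / ((r + 1) * z) = a * k / z"
    by (simp only: k_def)
  moreover have "a * k / z = c"
    using \<open>k \<noteq> 0\<close> c assms(1) by (simp add: z_def)
  ultimately show "c \<cdot> f \<in> additive_span {v. q v = a}"
    by simp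
qed

text \<open>If \<open>q\<close> vanished on \<open>orth\<close>, so would \<open>B\<close>, and
  \<open>u\<close> would lie in the radical.\<close>

lemma ex_anisotropic_orth:
  assumes "u \<in> orth" and "u \<noteq> 0"
  obtains w where "w \<in> orth" and "q w \<noteq> 0"
proof -
  have "\<exists>w\<in>orth. q w \<noteq> 0"
  proof (rule ccontr)
    assume "\<not> ?thesis"
    then have zero: "q w = 0" if "w \<in> orth" for w
      using that by blast
    have "B u y = 0" for y
    proof -
      obtain w where w: "w \<in> orth" and y: "y = B y f \<cdot> e + B y e \<cdot> f + w"
        by (rule decomposition)
      have "u + w \<in> orth"
        using assms(1) w by (simp add: orth_def)
      then have "B u w = 0"
        using zero assms(1) w by (simp add: polar_form_def)
      then have "B u (B y f \<cdot> e + B y e \<cdot> f + w) = 0"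
        using assms(1) by (simp add: orth_def B_commute[of u e] B_commute[of u f])
      with arg_cong[OF y, of "B u"] show ?thesis
        by (rule trans)
    qed
    then show False
      using nondegenerateD assms(2) by blast
  qed
  then show ?thesis
    using that by blast
qed

lemma span_eq_UNIV_if_orth_nonzero:
  assumes "a \<noteq> 0" and "u \<in> orth" and "u \<noteq> 0"
  shows "additive_span {v. q v = a} = UNIV"
proof (rule span_eq_UNIV_if_multiples_f[OF assms(1)])
  fix c :: 'f
  assume c: "c \<noteq> 0"
  obtain w where w: "w \<in> orth" and qw: "q w \<noteq> 0"
    using assms(2,3) by (rule ex_anisotropic_orth)
  show "c \<cdot> f \<in> additive_span {v. q v = a}"
  proof (cases "(2::'f) = 0")
    case True
    then obtain t where t: "t\<^sup>2 = a / q w"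
      by (rule char_two_square_surj)
    have "t \<cdot> w \<in> orth" and "q (t \<cdot> w) = a"
      using w qw t by (simp_all add: orth_def)
    \<comment> \<open>Both vectors have norm \<open>a\<close>, since \<open>f\<close> is isotropic
      and orthogonal to \<open>w\<close>.\<close>
    then have "(0 \<cdot> e + c \<cdot> f + t \<cdot> w) - t \<cdot> w \<in> additive_span {v. q v = a}"
      by (intro additive_span_diff additive_span_base) (simp_all only: mem_Collect_eq q_decomposition, simp)
    then show ?thesis
      by simp
  next
    case False
    \<comment> \<open>In \<open>?p w + ?p (- w) - ?r - ?r\<close> below, the \<open>e\<close> and
      \<open>w\<close> components cancel and the \<open>f\<close>-coefficient is
      \<open>- (2 * q w) / x\<close>; this \<open>x\<close> makes it \<open>c\<close>.\<close>
    define x where "x = - (2 * q w) / c"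
    have x: "x \<noteq> 0"
      using False qw c by (simp add: x_def)
    let ?p = "\<lambda>v. x \<cdot> e + ((a - q w) / x) \<cdot> f + v" and ?r = "x \<cdot> e + (a / x) \<cdot> f"
    have "- w \<in> orth"
      using w by (simp add: orth_def)
    then have p: "?p w \<in> additive_span {v. q v = a}" "?p (- w) \<in> additive_span {v. q v = a}"
      using w x by (simp_all add: additive_span_base q_decomposition del: add_uminus_conv_diff)
    have r: "?r \<in> additive_span {v. q v = a}"
      using x by (simp add: additive_span_base q_plane)
    have "?p w + ?p (- w) - ?r - ?r \<in> additive_span {v. q v = a}"
      by (rule additive_span_diff[OF additive_span_diff[OF additive_span_add[OF p] r] r])
    moreover have "?p w + ?p (- w) - ?r - ?r =
        ((a - q w) / x + (a - q w) / x - a / x - a / x) \<cdot> f"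
      by (simp only: scale_left_distrib scale_left_diff_distrib) (simp add: algebra_simps)
    moreover have "(a - q w) / x + (a - q w) / x - a / x - a / x = c"
    proof -
      have "(a - q w) / x + (a - q w) / x - a / x - a / x = - (2 * q w) / x"
        by (simp add: diff_divide_distrib)
      also have "\<dots> = c"
        using x c qw False by (simp add: x_def)
      finally show ?thesis .
    qed
    ultimately show ?thesis
      by simp
  qed
qed

text \<open>Without a complement \<open>e\<close> and \<open>f\<close> form a basis, and pairing
  with \<open>f\<close> and \<open>e\<close> reads off the coordinates.\<close>

lemma isometric_hyperbolic_plane:
  assumes "orth \<subseteq> {0}"
  shows "isometric smul q (*s) (hyperbolic_plane :: 'f ^ 2 \<Rightarrow> 'f)"
proof -
  let ?g = "\<lambda>v. (\<chi> i. if i = 1 then B v f else B v e) :: 'f ^ 2"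
  have v: "v = B v f \<cdot> e + B v e \<cdot> f" for v
  proof -
    obtain u where u: "u \<in> orth" and "v = B v f \<cdot> e + B v e \<cdot> f + u"
      by (rule decomposition)
    moreover have "u = 0"
      using u assms by blast
    ultimately show ?thesis
      by (simp only: add.right_neutral)
  qed
  have "Vector_Spaces.linear smul (*s) ?g"
    by unfold_locales (simp_all add: vec_eq_iff)
  moreover have "bij ?g"
  proof (rule bijI)
    show "inj ?g"
    proof (rule injI)
      fix v w
      assume "?g v = ?g w"
      then have "?g v $ 1 = ?g w $ 1" "?g v $ 2 = ?g w $ 2"
        by simp_all
      then have eq: "B v f = B w f" "B v e = B w e"
        by simp_all
      have "v = B v f \<cdot> e + B v e \<cdot> f"
        by (rule v)
      also have "\<dots> = w"
        unfolding eq by (rule v[symmetric])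
      finally show "v = w" .
    qed
    have "y = ?g (y $ 1 \<cdot> e + y $ 2 \<cdot> f)" for y :: "'f ^ 2"
      by (simp add: vec_eq_iff forall_2)
    then show "surj ?g"
      by (rule surjI[OF sym])
  qed
  moreover have "hyperbolic_plane (?g v) = q v" for v
  proof -
    have "hyperbolic_plane (?g v) = q (B v f \<cdot> e + B v e \<cdot> f)"
      by (simp add: hyperbolic_plane_def q_plane)
    also have "\<dots> = q v"
      by (rule arg_cong[OF v[symmetric]])
    finally show ?thesis .
  qed
  ultimately show ?thesis
    unfolding isometric_def by blast
qed

end

context finite_quadratic_space
begin

text \<open>Over \<open>\<F>\<^sub>2\<close>, \<open>\<F>\<^sub>3\<close>, \<open>\<F>\<^sub>4\<close> inversion of nonzero elements extends to an additive map \<open>\<phi>\<close>, so the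
  hyperbola \<open>x y = a\<close> lies in the proper subgroup \<open>y = a \<phi>(x)\<close>.\<close>

lemma small_hyperbolic_plane_not_span:
  assumes iso: "isometric smul q (*s) (hyperbolic_plane :: 'f ^ 2 \<Rightarrow> 'f)"
    and "a \<noteq> 0" and "CARD('f) \<in> {2, 3, 4}"
  shows "additive_span {v. q v = a} \<noteq> UNIV"
proof -
  obtain g where g: "Vector_Spaces.linear smul (*s) g" "bij g"
    and q: "\<And>v. hyperbolic_plane (g v :: 'f ^ 2) = q v"
    using iso unfolding isometric_def by blast
  interpret g: Vector_Spaces.linear smul "(*s)" g
    by (rule g(1))
  obtain \<phi> :: "'f \<Rightarrow> 'f" where diff: "\<And>x y. \<phi> (x - y) = \<phi> x - \<phi> y"
    and inv: "\<And>x. x \<noteq> 0 \<Longrightarrow> x * \<phi> x = 1"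
    using additive_inverse_small_field[OF assms(3)] by metis
  have "\<phi> 0 = 0"
    using diff[of 0 0] by simp
  have "additive_span {v. q v = a} \<subseteq> {v. g v $ 2 = a * \<phi> (g v $ 1)}"
  proof (rule additive_span_subset)
    show "{v. q v = a} \<subseteq> {v. g v $ 2 = a * \<phi> (g v $ 1)}"
    proof safe
      fix v
      assume "a = q v"
      then have a: "g v $ 1 * g v $ 2 = a"
        using q[of v] by (simp add: hyperbolic_plane_def)
      then have "g v $ 1 \<noteq> 0"
        using assms(2) by auto
      then have "a * \<phi> (g v $ 1) = g v $ 2"
        using inv a by (metis mult.commute mult.left_commute mult_1_right)
      then show "g v $ 2 = q v * \<phi> (g v $ 1)"
        using \<open>a = q v\<close> by simp
    qed
  qed (use \<open>\<phi> 0 = 0\<close> in \<open>simp_all add: g.zero g.diff diff right_diff_distrib\<close>)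
  \<comment> \<open>The point \<open>(0, 1)\<close> violates the equation of the subgroup because
    \<open>\<phi> 0 = 0\<close>.\<close>
  moreover obtain v where "g v = axis 2 1"
    using g(2) by (metis bij_pointE)
  ultimately have "v \<notin> additive_span {v. q v = a}"
    using \<open>\<phi> 0 = 0\<close> by (auto simp: axis_def)
  then show ?thesis
    by auto
qed

lemma isotropic_span:
  assumes "\<not> anisotropic q" and "a \<noteq> 0"
    and "\<not> (CARD('f) \<in> {2, 3, 4} \<and> isometric smul q (*s) (hyperbolic_plane :: 'f ^ 2 \<Rightarrow> 'f))"
  shows "additive_span {v. q v = a} = UNIV"
proof -
  obtain e where "q e = 0" "e \<noteq> 0"
    using assms(1) unfolding anisotropic_def by blast
  moreover obtain f where "q f = 0" "B e f = 1"
    using calculation by (rule hyperbolic_pair)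
  ultimately interpret hyperbolic_decomposition smul q e f
    by unfold_locales
  show ?thesis
  proof (cases "orth \<subseteq> {0}")
    case True
    then have "CARD('f) \<notin> {2, 3, 4}"
      using assms(3) isometric_hyperbolic_plane by blast
    moreover have "card {0, 1::'f} \<le> CARD('f)"
      by (intro card_mono) auto
    ultimately have "CARD('f) \<ge> 5"
      by auto
    then show ?thesis
      using assms(2) by (intro span_eq_UNIV_if_card_ge_5)
  next
    case False
    then obtain u where "u \<in> orth" "u \<noteq> 0"
      by blast
    with assms(2) show ?thesis
      by (rule span_eq_UNIV_if_orth_nonzero)
  qed
qed

section \<open>Anisotropic spaces\<close>

text \<open>In characteristic two multiples of \<open>s\<close> already attain every norm. Otherwise
  subtracting from \<open>x\<close> its projection onto \<open>s\<close> gives an orthogonal pair,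
  on which \<open>q\<close> is a binary diagonal form.\<close>

lemma anisotropic_universal:
  assumes "anisotropic q" and "s \<noteq> 0" and x: "\<And>c. x \<noteq> c \<cdot> s"
  obtains c d where "q (c \<cdot> s + d \<cdot> x) = a"
proof -
  have s: "q s \<noteq> 0"
    using assms(1,2) by (simp add: anisotropic_def)
  show ?thesis
  proof (cases "(2::'f) = 0")
    case True
    then obtain c where "c\<^sup>2 = a / q s"
      by (rule char_two_square_surj)
    then have "q (c \<cdot> s + 0 \<cdot> x) = a"
      using s by simp
    then show ?thesis
      by (rule that)
  next
    case False
    define k where "k = B x s / (2 * q s)"
    define v where "v = x - k \<cdot> s"
    have "v \<noteq> 0"
      using x by (simp add: v_def)
    then have "q v \<noteq> 0"
      using assms(1) by (simp add: anisotropic_def)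
    have "B s v = 0"
      using False s by (simp add: v_def k_def B_commute[of s x])
    obtain c d where "q s * c\<^sup>2 + q v * d\<^sup>2 = a"
      using s \<open>q v \<noteq> 0\<close> by (rule binary_diagonal_form_surj)
    then have "q (c \<cdot> s + d \<cdot> v) = a"
      using \<open>B s v = 0\<close> by (simp add: q_add mult.commute)
    moreover have "c \<cdot> s + d \<cdot> v = (c - d * k) \<cdot> s + d \<cdot> x"
      by (simp add: v_def algebra_simps)
    ultimately have "q ((c - d * k) \<cdot> s + d \<cdot> x) = a"
      by simp
    then show ?thesis
      by (rule that)
  qed
qed

text \<open>In characteristic two, take \<open>v\<close> orthogonal to \<open>s\<close> and off its
  line; as \<open>- q v / q s\<close> is a square, some \<open>c \<cdot> s + v\<close> is isotropic.
  Otherwise Gram-Schmidt gives orthogonal \<open>s\<close>, \<open>v\<close>, \<open>w\<close>, and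
  the form on the first two takes the value \<open>- q w\<close>.\<close>

lemma isotropic_if_three_independent:
  assumes "s \<noteq> 0" and x: "\<And>c. x \<noteq> c \<cdot> s" and z: "\<And>c d. z \<noteq> c \<cdot> s + d \<cdot> x"
  shows "\<not> anisotropic q"
proof
  assume aniso: "anisotropic q"
  then have qI: "q v \<noteq> 0" if "v \<noteq> 0" for v
    using that by (simp add: anisotropic_def)
  have s: "q s \<noteq> 0"
    using qI assms(1) by blast
  show False
  proof (cases "(2::'f) = 0")
    case True
    obtain v where v: "B s v = 0" "\<And>c. v \<noteq> c \<cdot> s"
    proof (cases "B s x = 0")
      case True
      then show ?thesis
        using x by (rule that)
    next
      case False
      \<comment> \<open>The multiple of \<open>x\<close> cancels the pairing of \<open>z\<close>
        with \<open>s\<close>; independence keeps the result off the line of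
        \<open>s\<close>.\<close>
      let ?v = "z - (B s z / B s x) \<cdot> x"
      have "B s ?v = 0"
        using False by simp
      moreover have "?v \<noteq> c \<cdot> s" for c
        using z by (metis diff_eq_eq)
      ultimately show ?thesis
        by (rule that)
    qed
    obtain c where c: "c\<^sup>2 = - q v / q s"
      using True by (rule char_two_square_surj)
    then have "q (c \<cdot> s + v) = 0"
      using s v(1) by (simp add: q_add)
    then have "c \<cdot> s + v = 0"
      using qI by blast
    then have "v = (- c) \<cdot> s"
      by (simp add: add_eq_0_iff)
    with v(2) show False
      by (rule notE)
  next
    case False
    define k where "k = B x s / (2 * q s)"
    define v where "v = x - k \<cdot> s"
    have "v \<noteq> 0"
      using x by (simp add: v_def)
    have v: "q v \<noteq> 0"
      using qI \<open>v \<noteq> 0\<close> by blast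
    have sv: "B s v = 0"
      using False s by (simp add: v_def k_def B_commute[of s x])
    define l m where "l = B z s / (2 * q s)" and "m = B z v / (2 * q v)"
    define w where "w = z - l \<cdot> s - m \<cdot> v"
    have "w \<noteq> 0"
    proof
      assume "w = 0"
      then have "z = l \<cdot> s + m \<cdot> (x - k \<cdot> s)"
        by (simp add: w_def v_def algebra_simps)
      also have "\<dots> = (l - m * k) \<cdot> s + m \<cdot> x"
        by (simp add: algebra_simps)
      finally have "z = (l - m * k) \<cdot> s + m \<cdot> x" .
      with z show False
        by (rule notE)
    qed
    then have w: "q w \<noteq> 0"
      using qI by blast
    have sw: "B s w = 0" and vw: "B v w = 0"
      using False s v sv by (simp_all add: w_def l_def m_def B_commute[of s z] B_commute[of v z]
          B_commute[of v s])
    obtain c d where "q s * c\<^sup>2 + q v * d\<^sup>2 = - q w"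
      using s v by (rule binary_diagonal_form_surj)
    then have "q (c \<cdot> s + d \<cdot> v + w) = 0"
      using sv sw vw by (simp add: q_add mult.commute)
    then have "c \<cdot> s + d \<cdot> v + w = 0"
      using qI by blast
    \<comment> \<open>Pairing with \<open>w\<close> isolates \<open>2 * q w\<close>, which is
      nonzero.\<close>
    then have "B (c \<cdot> s + d \<cdot> v + w) w = 0"
      by simp
    then show False
      using sw vw w False by simp
  qed
qed

text \<open>The scalars \<open>c\<close> with \<open>c W \<subseteq> W\<close>, where \<open>W\<close> is the span in question, form an additive
  group \<open>K\<close>. Since \<open>W\<close> is stable under reflections in vectors of norm \<open>a\<close>, and reflections act
  transitively on those vectors, \<open>B y s / a \<in> K\<close> whenever \<open>q y = q s = a\<close>. These quotients
  take each value at most twice, so \<open>K\<close> has more than half of the elements of the field.\<close>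

lemma scale_in_span:
  assumes aniso: "anisotropic q" and "a \<noteq> 0" and s: "q s = a" and y: "q y = a"
    and w: "w \<in> additive_span {v. q v = a}"
  shows "(B y s / a) \<cdot> w \<in> additive_span {v. q v = a}"
proof -
  have base: "(B y s / a) \<cdot> t \<in> additive_span {v. q v = a}" if t: "q t = a" for t
  proof -
    \<comment> \<open>The reflection taking \<open>s\<close> to \<open>t\<close> carries
      \<open>y\<close> to such a vector.\<close>
    obtain y' where y': "q y' = a" "B y' t = B y s"
    proof (cases "s = t")
      case True
      then show ?thesis
        using that[of y] y by simp
    next
      case False
      then have d: "q (s - t) \<noteq> 0"
        using aniso by (simp add: anisotropic_def)
      then have "reflect (s - t) s = t"
        using s t by (simp add: reflect_diff)
      then show ?thesis
        using that[of "reflect (s - t) y"] y q_reflect[OF d] B_reflect[OF d, of y s] by simp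
    qed
    have "q (reflect t y') = a"
      using q_reflect[of t y'] t y' assms(2) by simp
    \<comment> \<open>This difference is \<open>(B y' t / a) \<cdot> t\<close>.\<close>
    then have "y' - reflect t y' \<in> additive_span {v. q v = a}"
      using y' by (simp add: additive_span_diff additive_span_base)
    then show ?thesis
      using y' t by (simp add: reflect_def)
  qed
  show ?thesis
    using w
  proof induction
    case zero
    show ?case
      by (simp add: additive_span.zero)
  next
    case (add w t)
    then show ?case
      using base by (simp add: scale_right_distrib additive_span_add)
  next
    case (diff w t)
    then show ?case
      using base by (simp add: scale_right_diff_distrib additive_span_diff)
  qed
qed

text \<open>Reflecting \<open>s\<close> in \<open>d m = x + m \<cdot> s\<close> yields the quotients
  \<open>\<kappa> m\<close>. The equation \<open>\<kappa> m = t\<close> becomes quadratic in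
  \<open>m\<close> with leading coefficient \<open>- ((t + 2) * a\<^sup>2)\<close>, which is nonzero
  as \<open>\<kappa>\<close> avoids \<open>- 2\<close>. So \<open>\<kappa>\<close> takes at least
  half of all values, and \<open>- 2\<close>, obtained from \<open>- s\<close>, is one more element
  of \<open>K\<close>.\<close>

lemma anisotropic_plane_scale_span:
  assumes aniso: "anisotropic q" and a: "a \<noteq> 0" and s: "q s = a"
    and x: "\<And>c. x \<noteq> c \<cdot> s" and nonorth: "B s x \<noteq> 0 \<or> 2 * a \<noteq> 0"
    and w: "w \<in> additive_span {v. q v = a}"
  shows "c \<cdot> w \<in> additive_span {v. q v = a}"
proof -
  let ?W = "additive_span {v. q v = a}"
  define K where "K = {c. \<forall>w\<in>?W. c \<cdot> w \<in> ?W}"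
  define d where "d m = x + m \<cdot> s" for m
  define \<kappa> where "\<kappa> m = B (reflect (d m) s) s / a" for m
  have "d m \<noteq> 0" for m
    using x[of "- m"] by (auto simp: d_def add_eq_0_iff2)
  then have q_d: "q (d m) \<noteq> 0" for m
    using aniso by (simp add: anisotropic_def)
  have q_d_eq: "q (d m) = q x + m * B s x + m\<^sup>2 * a" and B_d_eq: "B s (d m) = B s x + 2 * a * m" for m
    using s by (simp_all add: d_def q_add B_commute[of x s])
  have "\<kappa> m \<in> K" for m
    using scale_in_span[OF aniso a s, of "reflect (d m) s"] q_reflect[OF q_d] s
    by (simp add: K_def \<kappa>_def)
  moreover have "- 2 \<in> K"
    using scale_in_span[OF aniso a s, of "- s"] a s by (simp add: K_def)
  ultimately have K: "insert (- 2) (range \<kappa>) \<subseteq> K"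
    by blast
  have \<kappa>: "(2 - \<kappa> m) * (a * q (d m)) = (B s (d m))\<^sup>2" for m
  proof -
    have "\<kappa> m = (2 * a - B s (d m) / q (d m) * B s (d m)) / a"
      using s by (simp add: \<kappa>_def reflect_def B_commute[of "d m" s])
    then show ?thesis
      using a q_d[of m] by (simp add: field_simps power2_eq_square)
  qed
  have not_minus_2: "\<kappa> m \<noteq> - 2" for m
  proof
    assume "\<kappa> m = - 2"
    then have "(2 + 2) * (a * q (d m)) = (B s (d m))\<^sup>2"
      using \<kappa>[of m] by simp
    then have *: "(2 + 2) * (a * q x) = (B s x)\<^sup>2"
      unfolding q_d_eq B_d_eq by (simp add: algebra_simps power2_eq_square)
    \<comment> \<open>This multiple of the component of \<open>x\<close> orthogonal to
      \<open>s\<close> is isotropic, hence zero; independence then forces \<open>2 * a = 0\<close>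
      and \<open>B s x = 0\<close>.\<close>
    have "q ((2 * a) \<cdot> x - B s x \<cdot> s) = a * ((2 + 2) * (a * q x) - (B s x)\<^sup>2)"
      using s by (simp add: q_diff B_commute[of x s] algebra_simps power2_eq_square)
    then have "q ((2 * a) \<cdot> x - B s x \<cdot> s) = 0"
      by (simp only: * diff_self mult_zero_right)
    then have "(2 * a) \<cdot> x - B s x \<cdot> s = 0"
      using aniso unfolding anisotropic_def by blast
    then have eq: "(2 * a) \<cdot> x = B s x \<cdot> s"
      by simp
    have "2 * a = 0"
    proof (rule ccontr)
      assume "2 * a \<noteq> 0"
      then have "x = (1 / (2 * a)) \<cdot> (2 * a) \<cdot> x"
        by simp
      also have "\<dots> = (1 / (2 * a) * B s x) \<cdot> s"
        by (simp only: eq scale_scale)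
      finally have "x = (1 / (2 * a) * B s x) \<cdot> s" .
      with x show False
        by (rule notE)
    qed
    moreover have "s \<noteq> 0"
      using a s by auto
    ultimately have "B s x = 0"
      using eq by (metis scale_eq_0_iff scale_zero_left)
    then show False
      using nonorth \<open>2 * a = 0\<close> by blast
  qed
  have "CARD('f) \<le> 2 * card (range \<kappa>)"
  proof (rule card_le_mult_card_image)
    fix t
    assume "t \<in> range \<kappa>"
    then obtain m where "t = \<kappa> m"
      by blast
    then have "t \<noteq> - 2"
      by (simp only: not_minus_2 not_False_eq_True)
    then have "t + 2 \<noteq> 0"
      by (metis eq_neg_iff_add_eq_0)
    let ?P = "\<lambda>m. (- ((t + 2) * a\<^sup>2)) * m\<^sup>2 + (- ((t + 2) * a * B s x)) * m
      + ((2 - t) * a * q x - (B s x)\<^sup>2)"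
    have "{m \<in> UNIV. \<kappa> m = t} \<subseteq> {m. ?P m = 0}"
    proof safe
      fix m
      have "(2 - \<kappa> m) * (a * q (d m)) - (B s (d m))\<^sup>2 = 0"
        using \<kappa> by simp
      then show "(- ((\<kappa> m + 2) * a\<^sup>2)) * m\<^sup>2 + (- ((\<kappa> m + 2) * a * B s x)) * m
          + ((2 - \<kappa> m) * a * q x - (B s x)\<^sup>2) = 0"
        unfolding q_d_eq B_d_eq by (simp add: algebra_simps power2_eq_square)
    qed
    then have "card {m \<in> UNIV. \<kappa> m = t} \<le> card {m. ?P m = 0}"
      by (intro card_mono) simp_all
    also have "\<dots> \<le> 2"
      using \<open>t + 2 \<noteq> 0\<close> a by (intro card_quadratic_roots_le) simp
    finally show "card {m \<in> UNIV. \<kappa> m = t} \<le> 2" .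
  qed simp
  moreover have "card (insert (- 2) (range \<kappa>)) = Suc (card (range \<kappa>))"
    using not_minus_2 by (intro card_insert_disjoint) (simp, metis imageE)
  moreover have "card (insert (- 2) (range \<kappa>)) \<le> card K"
    using K by (intro card_mono) simp_all
  ultimately have "CARD('f) < 2 * card K"
    by linarith
  then have "K = UNIV"
    by (rule two_mult_card_gt_imp_UNIV[rotated])
       (simp add: K_def scale_left_diff_distrib additive_span_diff)
  then show ?thesis
    using w unfolding K_def by blast
qed

text \<open>The span is closed under scaling, so one direction besides \<open>s\<close> suffices:
  \<open>s - reflect d s\<close> is a nonzero multiple of \<open>d = x + m \<cdot> s\<close> if
  \<open>B s d \<noteq> 0\<close>. Some \<open>m\<close> in \<open>{0, 1}\<close> achieves this, as
  \<open>s\<close> is not in the radical.\<close>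

lemma anisotropic_plane_span:
  assumes aniso: "anisotropic q" and a: "a \<noteq> 0" and s: "q s = a"
    and x: "\<And>c. x \<noteq> c \<cdot> s" and plane: "\<And>v. \<exists>c d. v = c \<cdot> s + d \<cdot> x"
  shows "additive_span {v. q v = a} = UNIV"
proof -
  let ?W = "additive_span {v. q v = a}"
  have nonorth: "B s x \<noteq> 0 \<or> 2 * a \<noteq> 0"
  proof (rule ccontr)
    assume "\<not> ?thesis"
    then have "B s v = 0" for v
      using plane[of v] s by auto
    then have "s = 0"
      by (rule nondegenerateD)
    then show False
      using a s by simp
  qed
  have scale: "c \<cdot> w \<in> ?W" if "w \<in> ?W" for c w
    using anisotropic_plane_scale_span[OF aniso a s x nonorth that] .
  obtain m where m: "B s (x + m \<cdot> s) \<noteq> 0"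
  proof (cases "B s x = 0")
    case True
    then show ?thesis
      using that[of 1] nonorth s by simp
  next
    case False
    then show ?thesis
      using that[of 0] by simp
  qed
  define d where "d = x + m \<cdot> s"
  have "B s d \<noteq> 0"
    using m by (simp add: d_def)
  then have "q d \<noteq> 0"
    using aniso B_right(5)[of s] unfolding anisotropic_def by metis
  have sW: "s \<in> ?W"
    using s by (simp add: additive_span_base)
  moreover have "reflect d s \<in> ?W"
    using q_reflect[OF \<open>q d \<noteq> 0\<close>] s by (simp add: additive_span_base)
  ultimately have "s - reflect d s \<in> ?W"
    by (rule additive_span_diff)
  then have "(B s d / q d) \<cdot> d \<in> ?W"
    by (simp add: reflect_def)
  then have "(q d / B s d) \<cdot> (B s d / q d) \<cdot> d \<in> ?W"
    by (rule scale)
  then have "d \<in> ?W"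
    using \<open>B s d \<noteq> 0\<close> \<open>q d \<noteq> 0\<close> by simp
  then have "d - m \<cdot> s \<in> ?W"
    using scale[OF sW] by (rule additive_span_diff)
  then have xW: "x \<in> ?W"
    by (simp add: d_def)
  have "v \<in> ?W" for v
  proof -
    obtain c k where "v = c \<cdot> s + k \<cdot> x"
      using plane by blast
    then show ?thesis
      using additive_span_add[OF scale[OF sW] scale[OF xW]] by simp
  qed
  then show ?thesis
    by auto
qed

text \<open>Two independent vectors suffice to represent \<open>a\<close> by some \<open>s\<close>.
  A third independent vector would make \<open>q\<close> isotropic, so \<open>s\<close> and any
  \<open>y\<close> off its line span the space.\<close>

lemma anisotropic_span:
  assumes aniso: "anisotropic q" and a: "a \<noteq> 0" and "(u::'v) \<noteq> 0" and not_line: "\<And>s::'v. \<exists>x. \<forall>c. x \<noteq> c \<cdot> s"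
  shows "additive_span {v. q v = a} = UNIV"
proof -
  obtain x where "\<And>c. x \<noteq> c \<cdot> u"
    using not_line by blast
  then obtain c d where "q (c \<cdot> u + d \<cdot> x) = a"
    by (rule anisotropic_universal[OF aniso assms(3)])
  then obtain s where s: "q s = a"
    by blast
  then have "s \<noteq> 0"
    using a by auto
  obtain y where y: "\<And>c. y \<noteq> c \<cdot> s"
    using not_line by blast
  have plane: "\<exists>c d. v = c \<cdot> s + d \<cdot> y" for v
  proof (rule ccontr)
    assume "\<not> ?thesis"
    then have "v \<noteq> c \<cdot> s + d \<cdot> y" for c d
      by blast
    from isotropic_if_three_independent[OF \<open>s \<noteq> 0\<close> y this] show False
      using aniso by contradiction
  qed
  show ?thesis
    by (rule anisotropic_plane_span[OF aniso a s y plane])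
qed

section \<open>Lines\<close>

text \<open>If \<open>q s = 0\<close>, then \<open>B s (c \<cdot> s) = 2 * c * q s = 0\<close> puts
  \<open>s\<close> into the radical.\<close>

lemma line_anisotropic:
  assumes line: "\<And>v. \<exists>c. v = c \<cdot> s" and "s \<noteq> 0"
  shows "anisotropic q" and "q s \<noteq> 0"
proof -
  show "q s \<noteq> 0"
  proof
    assume "q s = 0"
    then have "B s v = 0" for v
      using line[of v] by auto
    then show False
      using nondegenerateD assms(2) by blast
  qed
  show "anisotropic q"
    unfolding anisotropic_def
  proof (intro allI impI)
    fix v :: 'v
    assume "v \<noteq> 0"
    moreover obtain c where "v = c \<cdot> s"
      using line by blast
    ultimately show "q v \<noteq> 0"
      using \<open>q s \<noteq> 0\<close> by auto
  qed
qed

text \<open>If \<open>q t = a \<noteq> 0\<close>, then \<open>c \<cdot> t\<close> has norm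
  \<open>a\<close> only for \<open>c\<^sup>2 = 1\<close>, so the generators are \<open>t\<close> and
  \<open>- t\<close> and the span consists of the integer multiples of \<open>t\<close>.\<close>

lemma line_span_eq_UNIV_iff:
  assumes line: "\<And>v. \<exists>c. v = c \<cdot> s" and "s \<noteq> 0"
  shows "additive_span {v. q v = a} = UNIV \<longleftrightarrow> a \<in> nonzero_values q \<and> is_prime_field TYPE('f)"
proof -
  note aniso = line_anisotropic(1)[OF assms] and qs = line_anisotropic(2)[OF assms]
  show ?thesis
  proof (cases "a \<in> nonzero_values q")
    case False
    \<comment> \<open>This includes \<open>a = 0\<close>, where anisotropy leaves only the zero
      vector.\<close>
    then have "{v. q v = a} \<subseteq> {0}"
      using aniso by (auto simp: nonzero_values_def anisotropic_def)
    then have "additive_span {v. q v = a} \<subseteq> {0}"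
      by (intro additive_span_subset) auto
    then have "s \<notin> additive_span {v. q v = a}"
      using assms(2) by auto
    then show ?thesis
      using False by auto
  next
    case True
    then obtain t where t: "q t = a" and a: "a \<noteq> 0"
      unfolding nonzero_values_def by blast
    obtain k where k: "t = k \<cdot> s"
      using line by blast
    have "k \<noteq> 0"
      using a t k by auto
    have t0: "t \<noteq> 0"
      using a t by auto
    have t_line: "\<exists>c. v = c \<cdot> t" for v
    proof -
      obtain c where "v = c \<cdot> s"
        using line by blast
      then have "v = (c / k) \<cdot> t"
        using \<open>k \<noteq> 0\<close> k by simp
      then show ?thesis
        by blast
    qed
    have "additive_span {v. q v = a} = range (\<lambda>n. of_int n \<cdot> t)"
    proof
      have "{v. q v = a} \<subseteq> range (\<lambda>n. of_int n \<cdot> t)"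
      proof
        fix v
        assume "v \<in> {v. q v = a}"
        moreover obtain c where c: "v = c \<cdot> t"
          using t_line by blast
        ultimately have "c\<^sup>2 = 1"
          using a t by simp
        then have "c = of_int 1 \<or> c = of_int (- 1)"
          by (simp add: power2_eq_1_iff)
        then show "v \<in> range (\<lambda>n. of_int n \<cdot> t)"
          using c by blast
      qed
      moreover have "0 \<in> range (\<lambda>n. of_int n \<cdot> t)"
        by (rule range_eqI[of _ _ 0]) simp
      moreover have "v - w \<in> range (\<lambda>n. of_int n \<cdot> t)"
        if vw: "v \<in> range (\<lambda>n. of_int n \<cdot> t)" "w \<in> range (\<lambda>n. of_int n \<cdot> t)" for v w
      proof -
        obtain m n where "v = of_int m \<cdot> t" "w = of_int n \<cdot> t"
          using vw by blast
        then have "v - w = of_int (m - n) \<cdot> t"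
          by (simp add: scale_left_diff_distrib)
        then show ?thesis
          by (rule range_eqI)
      qed
      ultimately show "additive_span {v. q v = a} \<subseteq> range (\<lambda>n. of_int n \<cdot> t)"
        by (rule additive_span_subset)
      have tW: "t \<in> additive_span {v. q v = a}"
        using t by (simp add: additive_span_base)
      have "of_int n \<cdot> t \<in> additive_span {v. q v = a}" for n
      proof (induction n rule: int_induct[where k = 0])
        case base
        show ?case
          by (simp add: additive_span.zero)
      next
        case (step1 i)
        then show ?case
          using additive_span_add[OF _ tW] by (simp add: scale_left_distrib)
      next
        case (step2 i)
        then show ?case
          using additive_span_diff[OF _ tW] by (simp add: scale_left_diff_distrib)
      qed
      then show "range (\<lambda>n. of_int n \<cdot> t) \<subseteq> additive_span {v. q v = a}"
        by auto
    qed
    also have "\<dots> = UNIV \<longleftrightarrow> range (of_int :: int \<Rightarrow> 'f) = UNIV"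
    proof
      assume *: "range (\<lambda>n. of_int n \<cdot> t) = UNIV"
      have "c \<in> range of_int" for c :: 'f
      proof -
        have "c \<cdot> t \<in> range (\<lambda>n. of_int n \<cdot> t)"
          by (simp add: *)
        then show ?thesis
          using t0 by auto
      qed
      then show "range (of_int :: int \<Rightarrow> 'f) = UNIV"
        by auto
    next
      assume *: "range (of_int :: int \<Rightarrow> 'f) = UNIV"
      have "v \<in> range (\<lambda>n. of_int n \<cdot> t)" for v
      proof -
        obtain c where c: "v = c \<cdot> t"
          using t_line by blast
        have "c \<in> range of_int"
          by (simp add: *)
        then show ?thesis
          using c by auto
      qed
      then show "range (\<lambda>n. of_int n \<cdot> t) = UNIV"
        by auto
    qed
    finally show ?thesis
      using True by (simp add: range_of_int_eq_UNIV_iff_prime_field)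
  qed
qed

end

section \<open>Case distinction by dimension, by \<open>a\<close> and by isotropy\<close>

theorem theorem3p3:
  fixes smul :: "'f::{field,finite} \<Rightarrow> 'v::ab_group_add \<Rightarrow> 'v"
    and Basis :: "'v set"
    and q :: "'v \<Rightarrow> 'f"
    and a :: 'f
  assumes "finite_dimensional_vector_space smul Basis"
    and "vector_space.dim smul (UNIV :: 'v set) \<ge> 1"
    and "quadratic_form smul q"
    and "nondegenerate q"
  shows "Digraph_Component.connected (with_proj (representation_graph q a)) \<longleftrightarrow>
    \<not> ((a = 0 \<and> anisotropic q) \<or>
       (vector_space.dim smul (UNIV :: 'v set) = 1 \<and>
         (a \<notin> nonzero_values q \<or> \<not> is_prime_field TYPE('f))) \<or>
       (a \<noteq> 0 \<and> CARD('f) \<in> {2, 3, 4} \<and>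
         isometric smul q (*s) (hyperbolic_plane :: 'f ^ 2 \<Rightarrow> 'f)))"
proof -
  interpret finite_dimensional_vector_space smul Basis
    by (rule assms(1))
  interpret finite_quadratic_space smul q
    using assms(3,4) by unfold_locales
  let ?W = "additive_span {v. q v = a}"
  let ?small = "a \<noteq> 0 \<and> CARD('f) \<in> {2, 3, 4} \<and>
    isometric smul q (*s) (hyperbolic_plane :: 'f ^ 2 \<Rightarrow> 'f)"
  have small: "?W \<noteq> UNIV" if ?small
    using that small_hyperbolic_plane_not_span by blast
  obtain u :: 'v where u: "u \<noteq> 0"
  proof (rule ccontr)
    assume "\<not> thesis"
    then have "UNIV \<subseteq> span {}"
      using that by auto
    then have "dim UNIV \<le> card ({} :: 'v set)"
      by (rule dim_le_card) simp
    then show False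
      using assms(2) by simp
  qed
  show ?thesis
  proof (cases "dim UNIV = 1")
    case True
    obtain S where "UNIV \<subseteq> span S" "card S = dim UNIV"
      by (rule basis_exists[of UNIV])
    then obtain s where "UNIV \<subseteq> span {s}"
      using True by (metis card_1_singletonE)
    then have line: "\<exists>c. v = smul c s" for v
      unfolding span_singleton by blast
    have "s \<noteq> 0"
      using line[of u] u by auto
    from line_span_eq_UNIV_iff[OF line this]
    have "?W = UNIV \<longleftrightarrow> a \<in> nonzero_values q \<and> is_prime_field TYPE('f)" .
    \<comment> \<open>On a line exception (1) is therefore contained in exception (2).\<close>
    moreover have "a \<noteq> 0" if "a \<in> nonzero_values q"
      using that by (simp add: nonzero_values_def)
    ultimately show ?thesis
      unfolding connected_iff_additive_span using True small by blast
  next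
    case False
    have not_line: "\<exists>x. \<forall>c. x \<noteq> smul c s" for s
    proof (rule ccontr)
      assume "\<not> ?thesis"
      then have "UNIV \<subseteq> span {s}"
        unfolding span_singleton by blast
      then have "dim UNIV \<le> card {s}"
        by (rule dim_le_card) simp
      then show False
        using assms(2) False by simp
    qed
    show ?thesis
    proof (cases "a = 0")
      case True
      then have "?W = UNIV \<longleftrightarrow> \<not> anisotropic q"
        using isotropic_vectors_span anisotropic_zero_not_span[OF _ u] by blast
      then show ?thesis
        unfolding connected_iff_additive_span using True \<open>dim UNIV \<noteq> 1\<close> by blast
    next
      case a: False
      have "?W = UNIV" if "\<not> ?small"
      proof (cases "anisotropic q")
        case True
        then show ?thesis
          by (rule anisotropic_span[OF _ a u not_line])
      next
        case False
        then show ?thesis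
          using a that by (intro isotropic_span) auto
      qed
      then show ?thesis
        unfolding connected_iff_additive_span using a small \<open>dim UNIV \<noteq> 1\<close> by blast
    qed
  qed
qed

end
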